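(* In the binary model, suppose $\lambda\in(g,1)$, where $g=\frac{\sqrt5-1}{2}$. Then almost surely $S=\mathrm{supp}(\mu)$ has nonempty interior and is the closure of its interior.
   Context: Binary model. Let $T=\{1,2\}^*$ be the set of finite words over $\{1,2\}$ (the rooted binary tree; $v|j$ is the prefix of $v$ of length $j$). Let $\{a_v\}_{v\in T,\,|v|\ge1}$ be i.i.d. random variables with $\mathbb{P}(a_v=0)=\mathbb{P}(a_v=1)=\frac12$. Fix $\lambda\in(0,1)$. For $\omega\in\{1,2\}^{\mathbb{N}}$ put $f(\omega)=\sum_{j\ge1}a_{\omega|j}\lambda^j$. Let $\mu$ be the image under $f$ of the uniform product measure on $\{1,2\}^{\mathbb{N}}$, and $S=f(\{1,2\}^{\mathbb{N}})$ its (random, compact) support. *)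

theory Defs
  imports "HOL-Probability.Probability"
begin

text \<open>Binary model. Vertices of the binary tree are words over the alphabet
  {1,2}, encoded as bool lists (False = 1, True = 2). The labels a_v are
  i.i.d. fair coins; we index them by all words (the label of the root [] is
  never used). The probability space is the infinite product of fair
  Bernoulli measures.\<close>

definition coin_space :: "(bool list \<Rightarrow> bool) measure" where
  "coin_space = (\<Pi>\<^sub>M v\<in>UNIV. measure_pmf (bernoulli_pmf (1/2)))"

definition code_map :: "real \<Rightarrow> (bool list \<Rightarrow> bool) \<Rightarrow> (nat \<Rightarrow> bool) \<Rightarrow> real" where
  "code_map lam a \<omega> =
     (\<Sum>j. (if a (map \<omega> [0..<Suc j]) then 1 else 0) * lam ^ Suc j)"

definition rand_support :: "real \<Rightarrow> (bool list \<Rightarrow> bool) \<Rightarrow> real set" where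
  "rand_support lam a = range (code_map lam a)"

end

theory Submission
  imports Defs "HOL-Real_Asymp.Real_Asymp"
begin

text \<open>A point \<open>x\<close> of \<open>[0, L]\<close>, \<open>L = lam / (1 - lam)\<close>, lies in the support iff some branch of the
  tree carries a 0-1 expansion of \<open>x\<close> in base \<open>1 / lam\<close>. A vertex \<open>v\<close> at level \<open>n\<close> leaves the
  residual \<open>y = (x - partial_sum lam a v) / lam ^ n\<close>, and its two children have residual \<open>y / lam\<close>
  or \<open>y / lam - 1\<close>, each independently with probability 1/2. For \<open>lam > g\<close> an orbit cannot jump
  over the region in which both digits are admissible, which yields a weight \<open>h \<ge> 0\<close> on \<open>[0, L]\<close>
  with \<open>h (y' / lam) + h (y' / lam - 1) \<ge> \<beta> * h y\<close> for some \<open>\<beta> > 1\<close> and all \<open>y'\<close> near \<open>y\<close>.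
  Hence the total weight of the residuals of \<open>x\<close> at level \<open>n\<close> grows exponentially, and an
  exponential moment estimate bounds the probability that it fails to grow in the next step by
  something doubly exponentially small in \<open>n\<close>. This beats the exponentially growing number of
  points of a \<open>lam ^ n\<close>-net, so once the weight is large (for instance when all labels of the
  first \<open>m\<close> levels vanish) a whole interval is covered with positive probability. The event that
  no subtree has a support with interior passes to the two subtrees of the root, which are
  independent copies of the whole tree; its probability thus satisfies \<open>q \<le> q\<^sup>2\<close>, \<open>q < 1\<close>, and
  vanishes.\<close>

section \<open>The random support\<close>

definition partial_sum :: "real \<Rightarrow> (bool list \<Rightarrow> bool) \<Rightarrow> bool list \<Rightarrow> real" where
  "partial_sum lam a v = (\<Sum>j<length v. of_bool (a (take (Suc j) v)) * lam ^ Suc j)"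

definition subtree :: "bool list \<Rightarrow> (bool list \<Rightarrow> bool) \<Rightarrow> bool list \<Rightarrow> bool" where
  "subtree v a = (\<lambda>w. a (v @ w))"

lemma subtree_append: "subtree w (subtree v a) = subtree (v @ w) a"
  by (simp add: subtree_def)

lemma partial_sum_Nil [simp]: "partial_sum lam a [] = 0"
  by (simp add: partial_sum_def)

lemma partial_sum_snoc:
  "partial_sum lam a (v @ [b]) = partial_sum lam a v + of_bool (a (v @ [b])) * lam ^ Suc (length v)"
  by (simp add: partial_sum_def)

lemma partial_sum_cong:
  assumes "\<And>w. length w \<le> length v \<Longrightarrow> a w = b w"
  shows "partial_sum lam a v = partial_sum lam b v"
  unfolding partial_sum_def using assms by (intro sum.cong) auto

lemma code_map_of_bool:
  "code_map lam a \<omega> = (\<Sum>j. of_bool (a (map \<omega> [0..<Suc j])) * lam ^ Suc j)"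
  unfolding code_map_def of_bool_def ..

section \<open>Self-similarity and closedness of the support\<close>

context
  fixes lam :: real
  assumes lam: "0 < lam" "lam < 1"
begin

lemma geometric_tail_sums: "(\<lambda>j. lam ^ Suc j) sums (lam / (1 - lam))"
  using sums_mult[OF geometric_sums[of lam], of lam] lam by simp

lemma summable_code_map: "summable (\<lambda>j. of_bool (P j) * lam ^ Suc j)"
proof (rule summable_comparison_test'[OF sums_summable[OF geometric_tail_sums]])
  show "norm (of_bool (P n) * lam ^ Suc n) \<le> lam ^ Suc n" for n
    using lam by (cases "P n") (auto simp: norm_mult norm_power)
qed

lemma code_map_bounds: "0 \<le> code_map lam a \<omega>" "code_map lam a \<omega> \<le> lam / (1 - lam)"
proof -
  show "0 \<le> code_map lam a \<omega>"
    unfolding code_map_of_bool using summable_code_map lam by (intro suminf_nonneg) auto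
  have "code_map lam a \<omega> \<le> (\<Sum>j. lam ^ Suc j)"
    unfolding code_map_of_bool
    using lam by (intro suminf_le[OF _ summable_code_map sums_summable[OF geometric_tail_sums]])
      (auto simp: of_bool_def)
  also have "\<dots> = lam / (1 - lam)"
    using geometric_tail_sums by (simp add: sums_iff)
  finally show "code_map lam a \<omega> \<le> lam / (1 - lam)" .
qed

text \<open>Self-similarity: the terms of index at least \<open>n\<close> read only labels strictly
  below the vertex \<open>map \<omega> [0..<n]\<close>, and with \<open>lam ^ n\<close> factored out
  they form the series of the shifted branch in that subtree.\<close>

lemma code_map_split:
  "code_map lam a \<omega> =
     partial_sum lam a (map \<omega> [0..<n]) + lam ^ n * code_map lam (subtree (map \<omega> [0..<n]) a) (\<lambda>i. \<omega> (i + n))"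
proof -
  define f where "f j = of_bool (a (map \<omega> [0..<Suc j])) * lam ^ Suc j" for j
  have sm: "summable f"
    unfolding f_def by (rule summable_code_map)
  have *: "map \<omega> [0..<n] @ map (\<lambda>i. \<omega> (i + n)) [0..<Suc j] = map \<omega> [0..<Suc (j + n)]" for j
    by (intro nth_equalityI) (auto simp: nth_append simp del: upt_Suc)
  have "code_map lam a \<omega> = (\<Sum>j. f (j + n)) + (\<Sum>j<n. f j)"
    unfolding code_map_of_bool f_def[symmetric] by (rule suminf_split_initial_segment[OF sm])
  moreover have "(\<Sum>j<n. f j) = partial_sum lam a (map \<omega> [0..<n])"
    unfolding partial_sum_def f_def by (auto simp: take_map intro!: sum.cong simp del: upt_Suc)
  moreover have "(\<Sum>j. f (j + n)) = lam ^ n * code_map lam (subtree (map \<omega> [0..<n]) a) (\<lambda>i. \<omega> (i + n))"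
    unfolding code_map_of_bool subtree_def *
    by (subst suminf_mult[symmetric, OF summable_code_map]) (simp add: f_def power_add mult_ac)
  ultimately show ?thesis by simp
qed

lemma rand_support_subtree_subset:
  "(\<lambda>z. partial_sum lam a v + lam ^ length v * z) ` rand_support lam (subtree v a) \<subseteq> rand_support lam a"
proof clarsimp
  fix z assume "z \<in> rand_support lam (subtree v a)"
  then obtain \<omega> where \<omega>: "z = code_map lam (subtree v a) \<omega>"
    by (auto simp: rand_support_def)
  define \<omega>' where "\<omega>' i = (if i < length v then v ! i else \<omega> (i - length v))" for i
  have "map \<omega>' [0..<length v] = v" "(\<lambda>i. \<omega>' (i + length v)) = \<omega>"
    by (auto simp: \<omega>'_def intro: nth_equalityI)
  hence "partial_sum lam a v + lam ^ length v * z = code_map lam a \<omega>'"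
    using code_map_split[of a \<omega>' "length v"] \<omega> by simp
  thus "partial_sum lam a v + lam ^ length v * z \<in> rand_support lam a"
    by (simp add: rand_support_def)
qed

lemma dist_partial_sum_le:
  assumes "z \<in> (\<lambda>z. partial_sum lam a v + lam ^ length v * z) ` rand_support lam b"
  shows "\<bar>z - partial_sum lam a v\<bar> \<le> lam ^ length v * (lam / (1 - lam))"
proof -
  obtain \<omega> where "z = partial_sum lam a v + lam ^ length v * code_map lam b \<omega>"
    using assms by (auto simp: rand_support_def)
  thus ?thesis
    using code_map_bounds[of b \<omega>] lam by (simp add: mult_left_mono abs_mult del: times_divide_eq_right)
qed

lemma rand_support_decompose:
  "rand_support lam a = (\<Union>b. (\<lambda>z. partial_sum lam a [b] + lam * z) ` rand_support lam (subtree [b] a))"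
proof
  show "(\<Union>b. (\<lambda>z. partial_sum lam a [b] + lam * z) ` rand_support lam (subtree [b] a)) \<subseteq> rand_support lam a"
  proof (rule UN_least)
    show "(\<lambda>z. partial_sum lam a [b] + lam * z) ` rand_support lam (subtree [b] a) \<subseteq> rand_support lam a" for b
      using rand_support_subtree_subset[of a "[b]"] by simp
  qed
  show "rand_support lam a \<subseteq> (\<Union>b. (\<lambda>z. partial_sum lam a [b] + lam * z) ` rand_support lam (subtree [b] a))"
  proof
    fix x assume "x \<in> rand_support lam a"
    then obtain \<omega> where "x = code_map lam a \<omega>"
      by (auto simp: rand_support_def)
    hence "x = partial_sum lam a [\<omega> 0] + lam * code_map lam (subtree [\<omega> 0] a) (\<lambda>i. \<omega> (i + 1))"
      using code_map_split[of a \<omega> 1] by simp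
    thus "x \<in> (\<Union>b. (\<lambda>z. partial_sum lam a [b] + lam * z) ` rand_support lam (subtree [b] a))"
      unfolding rand_support_def by blast
  qed
qed

lemma power_mult_tendsto_0: "(\<lambda>n. C * lam ^ n) \<longlonglongrightarrow> 0"
  using lam by (auto intro!: tendsto_mult_right_zero LIMSEQ_power_zero)

lemma eq_if_dist_le_power:
  fixes x y :: real
  assumes "\<And>n. \<bar>x - y\<bar> \<le> C * lam ^ n"
  shows "x = y"
  using LIMSEQ_le_const[OF power_mult_tendsto_0[of C], of "\<bar>x - y\<bar>"] assms by auto

lemma closed_rand_support: "closed (rand_support lam a)"
proof -
  \<comment> \<open>Koenig's lemma: if \<open>x\<close> is adherent to the piece below \<open>v\<close>, then also to the piece below a child of \<open>v\<close>.\<close>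
  let ?L = "lam / (1 - lam)"
  define Q where "Q v x \<longleftrightarrow> x \<in> closure ((\<lambda>z. partial_sum lam a v + lam ^ length v * z) ` rand_support lam (subtree v a))"
    for v and x
  have step: "\<exists>b. Q (v @ [b]) x" if "Q v x" for v x
  proof -
    have "(\<lambda>z. partial_sum lam a v + lam ^ length v * z) ` rand_support lam (subtree v a) =
      (\<Union>b. (\<lambda>z. partial_sum lam a (v @ [b]) + lam ^ length (v @ [b]) * z) ` rand_support lam (subtree (v @ [b]) a))"
      unfolding rand_support_decompose[of "subtree v a"] image_UN image_image
      by (simp add: subtree_append partial_sum_snoc subtree_def
          partial_sum_snoc[of _ _ "[]", simplified] algebra_simps)
    with that show ?thesis
      by (auto simp: Q_def UNIV_bool closure_Un)
  qed
  have "x \<in> rand_support lam a" if x: "x \<in> closure (rand_support lam a)" for x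
  proof -
    have "Q [] x"
      using x by (simp add: Q_def subtree_def)
    have "\<exists>V. \<forall>n. (Q (V n) x \<and> length (V n) = n) \<and> (\<exists>b. V (Suc n) = V n @ [b])"
    proof (rule dependent_nat_choice)
      show "\<exists>v. Q v x \<and> length v = 0"
        using \<open>Q [] x\<close> by auto
      show "\<exists>v'. (Q v' x \<and> length v' = Suc n) \<and> (\<exists>b. v' = v @ [b])"
        if "Q v x \<and> length v = n" for v n
        using step[of v x] that by auto
    qed
    then obtain V where V: "\<And>n. Q (V n) x \<and> length (V n) = n" "\<And>n. \<exists>b. V (Suc n) = V n @ [b]"
      by blast
    \<comment> \<open>The words \<open>V n\<close> extend one another, so the letter at position
      \<open>n\<close> first appears in \<open>V (Suc n)\<close> and never changes
      afterwards.\<close>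
    define \<omega> where "\<omega> n = V (Suc n) ! n" for n
    have V_eq: "V n = map \<omega> [0..<n]" for n
    proof (induction n)
      case 0
      show ?case using V(1)[of 0] by simp
    next
      case (Suc n)
      obtain b where b: "V (Suc n) = V n @ [b]" using V(2) by blast
      hence "\<omega> n = b" using V(1)[of n] by (simp add: \<omega>_def nth_append)
      with b Suc show ?case by simp
    qed
    \<comment> \<open>Both points lie within \<open>lam ^ n * ?L\<close> of the partial sum at
      \<open>V n\<close>: the limit point \<open>x\<close> because a closed ball contains the
      closure of the piece, the coded point because it lies in the piece.\<close>
    have "\<bar>x - code_map lam a \<omega>\<bar> \<le> (2 * ?L) * lam ^ n" for n
    proof -
      let ?p = "partial_sum lam a (V n)"
      have len: "length (V n) = n" using V by blast
      have "(\<lambda>z. ?p + lam ^ n * z) ` rand_support lam (subtree (V n) a) \<subseteq> cball ?p (lam ^ n * ?L)"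
        using dist_partial_sum_le[of _ a "V n"] len by (force simp: dist_real_def)
      hence "closure ((\<lambda>z. ?p + lam ^ n * z) ` rand_support lam (subtree (V n) a)) \<subseteq> cball ?p (lam ^ n * ?L)"
        by (rule closure_minimal[OF _ closed_cball])
      hence "x \<in> cball ?p (lam ^ n * ?L)"
        using V(1)[of n] unfolding Q_def len by blast
      moreover have "code_map lam a \<omega> \<in> cball ?p (lam ^ n * ?L)"
        using dist_partial_sum_le[of "code_map lam a \<omega>" a "V n" "subtree (V n) a"] code_map_split[of a \<omega> n] len
        by (auto simp: dist_real_def V_eq rand_support_def abs_minus_commute)
      moreover have "(2 * ?L) * lam ^ n = lam ^ n * ?L + lam ^ n * ?L"
        by simp
      ultimately show ?thesis
        unfolding mem_cball dist_real_def by linarith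
    qed
    hence "x = code_map lam a \<omega>" by (rule eq_if_dist_le_power)
    thus ?thesis by (simp add: rand_support_def)
  qed
  thus ?thesis by (simp add: closure_subset_eq[symmetric] subsetI)
qed

text \<open>Reduces membership to finite levels. The piece of the support below \<open>v\<close> is
  within \<open>lam ^ n * ?L\<close> of the partial sum at \<open>v\<close>, so such an
  \<open>x\<close> is a limit of points of the support, which is closed.\<close>

lemma mem_rand_support_if_approx:
  assumes "\<And>n. N \<le> n \<Longrightarrow> \<exists>v. length v = n \<and> \<bar>x - partial_sum lam a v\<bar> \<le> C * lam ^ n"
  shows "x \<in> rand_support lam a"
proof -
  let ?L = "lam / (1 - lam)"
  have "\<exists>y\<in>rand_support lam a. dist y x < e" if "e > 0" for e
  proof -
    have "\<forall>\<^sub>F n in sequentially. (C + ?L) * lam ^ n < e"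
      by (rule order_tendstoD(2)[OF power_mult_tendsto_0 that])
    then obtain M where "\<And>n. n \<ge> M \<Longrightarrow> (C + ?L) * lam ^ n < e"
      by (auto simp: eventually_sequentially)
    hence n: "max M N \<ge> N" "(C + ?L) * lam ^ max M N < e"
      by auto
    obtain v where v: "length v = max M N" "\<bar>x - partial_sum lam a v\<bar> \<le> C * lam ^ max M N"
      using assms n(1) by blast
    obtain z where z: "z \<in> (\<lambda>z. partial_sum lam a v + lam ^ length v * z) ` rand_support lam (subtree v a)"
      by (auto simp: rand_support_def)
    have "dist z x < e"
      using v(2) dist_partial_sum_le[OF z] n(2)
      unfolding v(1) dist_real_def distrib_right mult.commute[of ?L] by linarith
    thus ?thesis using z rand_support_subtree_subset by blast
  qed
  hence "x \<in> closure (rand_support lam a)"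
    by (simp add: closure_approachable)
  thus ?thesis using closed_rand_support by simp
qed

lemma interior_subtree_subset:
  "(\<lambda>z. partial_sum lam a v + lam ^ length v * z) ` interior (rand_support lam (subtree v a))
     \<subseteq> interior (rand_support lam a)"
proof (rule interior_maximal)
  show "(\<lambda>z. partial_sum lam a v + lam ^ length v * z) ` interior (rand_support lam (subtree v a))
     \<subseteq> rand_support lam a"
    using rand_support_subtree_subset[of a v] interior_subset by blast
  have "(+) (partial_sum lam a v) ` (*) (lam ^ length v) ` interior (rand_support lam (subtree v a)) =
    (\<lambda>z. partial_sum lam a v + lam ^ length v * z) ` interior (rand_support lam (subtree v a))"
    by (simp add: image_image)
  thus "open ((\<lambda>z. partial_sum lam a v + lam ^ length v * z) ` interior (rand_support lam (subtree v a)))"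
    using lam open_translation[OF open_scaling[of "lam ^ length v" "interior (rand_support lam (subtree v a))"], of "partial_sum lam a v"]
    by simp
qed

text \<open>Each point of the support lies, for every \<open>n\<close>, in the piece below some
  \<open>v\<close> of length \<open>n\<close>, whose diameter is of order \<open>lam ^ n\<close>. A
  descendant of \<open>v\<close> with interior puts an interior point of the whole support into this
  small piece.\<close>

lemma closure_interior_rand_support:
  assumes "\<And>v. \<exists>w. interior (rand_support lam (subtree (v @ w) a)) \<noteq> {}"
  shows "closure (interior (rand_support lam a)) = rand_support lam a"
proof
  show "closure (interior (rand_support lam a)) \<subseteq> rand_support lam a"
    using closed_rand_support interior_subset by (intro closure_minimal)
  let ?L = "lam / (1 - lam)"
  show "rand_support lam a \<subseteq> closure (interior (rand_support lam a))"
  proof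
    fix x assume "x \<in> rand_support lam a"
    then obtain \<omega> where \<omega>: "x = code_map lam a \<omega>"
      by (auto simp: rand_support_def)
    have "\<exists>y\<in>interior (rand_support lam a). dist y x < e" if "e > 0" for e
    proof -
      have "\<forall>\<^sub>F n in sequentially. (2 * ?L) * lam ^ n < e"
        using order_tendstoD(2)[OF power_mult_tendsto_0 that] .
      then obtain n where n: "(2 * ?L) * lam ^ n < e"
        by (auto simp: eventually_sequentially)
      define v where "v = map \<omega> [0..<n]"
      have len: "length v = n" by (simp add: v_def)
      obtain w where w: "interior (rand_support lam (subtree (v @ w) a)) \<noteq> {}"
        using assms by blast
      have "interior (rand_support lam (subtree v a)) \<noteq> {}"
        using w interior_subtree_subset[of "subtree v a" w] by (auto simp: subtree_append)
      then obtain z where z: "z \<in> interior (rand_support lam (subtree v a))" by blast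
      define y where "y = partial_sum lam a v + lam ^ length v * z"
      have "y \<in> interior (rand_support lam a)"
        using interior_subtree_subset[of a v] z by (auto simp: y_def)
      moreover have "dist y x < e"
      proof -
        have "\<bar>y - partial_sum lam a v\<bar> \<le> lam ^ n * ?L"
          using dist_partial_sum_le[of y a v "subtree v a"] z interior_subset len by (auto simp: y_def)
        moreover have "\<bar>x - partial_sum lam a v\<bar> \<le> lam ^ n * ?L"
          using dist_partial_sum_le[of x a v "subtree v a"] len code_map_split[of a \<omega> n]
          by (auto simp: \<omega> v_def rand_support_def)
        moreover have "(2 * ?L) * lam ^ n = lam ^ n * ?L + lam ^ n * ?L"
          by simp
        ultimately show ?thesis
          using n unfolding dist_real_def by linarith
      qed
      ultimately show ?thesis by blast
    qed
    thus "x \<in> closure (interior (rand_support lam a))"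
      by (simp add: closure_approachable)
  qed
qed

end

section \<open>Expansion weights above the golden ratio\<close>

text \<open>All that the probabilistic part needs of the weight. The tolerance
  \<open>\<epsilon>\<close> in \<open>h_expand\<close> pays for moving from one net point to
  another; \<open>h_ge\<close> starts the growth; \<open>h_pos\<close> turns positive weight into a
  vertex whose partial sum is close to the target.\<close>

locale expansion_weight =
  fixes lam \<beta> \<epsilon> \<delta> :: real and h :: "real \<Rightarrow> real"
  assumes lam: "0 < lam" "lam < 1"
    and \<beta>: "1 < \<beta>" and \<epsilon>: "0 < \<epsilon>" and \<delta>: "0 < \<delta>" "2 * \<delta> < lam / (1 - lam)"
    and h_nonneg: "\<And>y. 0 \<le> h y" and h_le_1: "\<And>y. h y \<le> 1"
    and h_pos: "\<And>y. 0 < h y \<Longrightarrow> 0 \<le> y \<and> y \<le> lam / (1 - lam)"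
    and h_ge: "\<And>y. \<delta> \<le> y \<Longrightarrow> y \<le> lam / (1 - lam) - \<delta> \<Longrightarrow> 1 / 2 \<le> h y"
    and h_expand: "\<And>y y'. \<bar>y - y'\<bar> \<le> \<epsilon> \<Longrightarrow> \<beta> * h y \<le> h (y' / lam) + h (y' / lam - 1)"

lemma expansion_weight_exists:
  fixes lam :: real
  assumes "(sqrt 5 - 1) / 2 < lam" and "lam < 1"
  obtains h \<beta> \<epsilon> \<delta> where "expansion_weight lam \<beta> \<epsilon> \<delta> h"
proof -
  define L where "L = lam / (1 - lam)"
  have "2 < sqrt (5::real)" by (simp add: real_less_rsqrt)
  hence lam: "1 / 2 < lam" "lam < 1" using assms by auto
  have L: "L * (1 - lam) = lam" using lam by (simp add: L_def)
  have "0 < L" using lam by (simp add: L_def)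
  have gold: "1 < lam\<^sup>2 + lam"
  proof -
    have "(sqrt 5)\<^sup>2 < (2 * lam + 1)\<^sup>2"
      using assms by (intro power_strict_mono) auto
    thus ?thesis by (simp add: power2_eq_square algebra_simps)
  qed
  \<comment> \<open>The golden ratio condition says that \<open>lam < L - 1\<close>: a residual \<open>y < lam\<close>, for which the digit 0
    is forced, moves away from the boundary of \<open>[0, L]\<close> when it is replaced by \<open>y / lam\<close>.\<close>
  define \<Delta> where "\<Delta> = L - 1 - lam"
  have "\<Delta> * (1 - lam) = lam\<^sup>2 + lam - 1"
    using L by (simp add: \<Delta>_def power2_eq_square algebra_simps)
  hence \<Delta>: "0 < \<Delta>" using gold lam by (smt (verit) zero_less_mult_iff mult_nonpos_nonneg)
  \<comment> \<open>The margins fit together: \<open>L = 1 + lam + 8 * \<eta>\<close> and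
    \<open>\<delta> = \<eta> / 2\<close> leave room for an error \<open>\<eta> + \<epsilon>\<close>
    that at most doubles on division by \<open>lam\<close>, as \<open>lam > 1 / 2\<close>. The value
    \<open>2 * \<epsilon> = \<delta> * (1 - lam)\<close> is the least of \<open>y - y * lam\<close>
    over \<open>y \<ge> \<delta>\<close>.\<close>
  define \<eta> where "\<eta> = \<Delta> / 8"
  define \<delta> where "\<delta> = \<Delta> / 16"
  define \<epsilon> where "\<epsilon> = \<delta> * (1 - lam) / 2"
  \<comment> \<open>The worse of two gains. One digit raises \<open>d\<close> by at least
    \<open>\<epsilon>\<close>, hence \<open>1 + d / L\<close>, which is at most 2, by a factor of at
    least \<open>1 + \<epsilon> / (2 * L)\<close>. Two digits give at least
    \<open>1 / 2 + 1 / 2\<close> against \<open>h y \<le> 3 / 4\<close>.\<close>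
  define \<beta> where "\<beta> = min (4 / 3) (1 + \<epsilon> / (2 * L))"
  define d where "d y = min y (L - y)" for y
  \<comment> \<open>The cut-off at \<open>\<delta>\<close> makes the expansion inequality robust under perturbations of \<open>y\<close>. The offset 1
    makes \<open>h\<close> vary by less than a factor 2, so that two admissible digits always suffice.\<close>
  define h where "h y = (if \<delta> \<le> d y then (1 + d y / L) / 2 else 0)" for y
  have \<delta>\<epsilon>: "0 < \<delta>" "0 < \<epsilon>" "\<epsilon> < \<delta> / 2"
    using \<Delta> lam by (simp_all add: \<delta>_def \<epsilon>_def)
  have "1 < \<beta>"
    using \<delta>\<epsilon> \<open>0 < L\<close> by (simp add: \<beta>_def)
  moreover have "2 * \<delta> < L" "0 < \<eta>"
    using \<Delta> lam by (simp_all add: \<delta>_def \<eta>_def \<Delta>_def)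
  moreover have "\<delta> \<le> \<eta> - \<epsilon>"
    using \<delta>\<epsilon>(2,3) by (simp add: \<delta>_def \<eta>_def)
  ultimately have pos: "0 < \<delta>" "0 < \<epsilon>" "\<epsilon> < \<delta> / 2" "1 < \<beta>" "2 * \<delta> < L" "0 < \<eta>" "\<delta> \<le> \<eta> - \<epsilon>"
    using \<delta>\<epsilon> by auto
  have h0: "0 \<le> h y" for y
    using pos \<open>0 < L\<close> by (auto simp: h_def)
  have dL: "d y \<le> L / 2" for y unfolding d_def by linarith
  have h_le: "h y \<le> (1 + 1 / 2) / 2" for y
    using dL[of y] \<open>0 < L\<close> by (auto simp: h_def field_simps)
  \<comment> \<open>The reflection of \<open>[0, L]\<close> preserves \<open>h\<close> and, by
    \<open>Ll\<close>, exchanges the two digits, so the right end follows from the left end.\<close>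
  have h_sym: "h (L - y) = h y" for y
    by (simp add: h_def d_def min.commute)
  have Ll: "(L - y) / lam = L - (y / lam - 1)" for y
    using L lam by (simp add: field_simps)
  \<comment> \<open>Near the left end digit 0 suffices alone: \<open>y' / lam\<close> is at distance
    at least \<open>y + \<epsilon>\<close>, hence \<open>d y + \<epsilon>\<close>, from both
    endpoints.\<close>
  have left: "\<beta> * h y \<le> h (y' / lam)" if y: "\<delta> \<le> y" "y \<le> lam + \<eta>" "\<bar>y - y'\<bar> \<le> \<epsilon>" for y y'
  proof -
    have "y + \<epsilon> \<le> y' / lam"
    proof -
      have "(y + \<epsilon>) * lam \<le> y - \<epsilon>"
      proof -
        have "2 * \<epsilon> = \<delta> * (1 - lam)" by (simp add: \<epsilon>_def)
        also have "\<dots> \<le> y * (1 - lam)" using y lam by (intro mult_right_mono) auto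
        finally have "2 * \<epsilon> \<le> y - y * lam" by (simp add: algebra_simps)
        moreover have "\<epsilon> * lam \<le> \<epsilon>" using pos lam by simp
        ultimately show ?thesis by (simp add: distrib_right)
      qed
      also have "\<dots> \<le> y'" using y by auto
      finally show ?thesis using lam by (simp add: field_simps)
    qed
    moreover have "y + \<epsilon> \<le> L - y' / lam"
    proof -
      have "y' / lam \<le> (lam + (\<eta> + \<epsilon>)) / lam"
        using y lam by (intro divide_right_mono) auto
      also have "\<dots> = 1 + (\<eta> + \<epsilon>) / lam" using lam by (simp add: field_simps)
      also have "(\<eta> + \<epsilon>) / lam \<le> 2 * (\<eta> + \<epsilon>)"
      proof -
        have "(\<eta> + \<epsilon>) * 1 \<le> (\<eta> + \<epsilon>) * (2 * lam)"
          using pos lam by (intro mult_left_mono) auto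
        thus ?thesis using lam by (simp add: field_simps)
      qed
      finally have "y' / lam \<le> 1 + 2 * (\<eta> + \<epsilon>)" by simp
      moreover have "L = 1 + lam + 8 * \<eta>" "\<delta> = \<eta> / 2"
        by (simp_all add: \<Delta>_def \<eta>_def \<delta>_def field_simps)
      ultimately show ?thesis
        using y(2) pos(2,3,6) by argo
    qed
    ultimately have d: "d y + \<epsilon> \<le> d (y' / lam)" "\<delta> \<le> d (y' / lam)"
      using y(1) pos(2) by (auto simp: d_def)
    show ?thesis
    proof (cases "\<delta> \<le> d y")
      case True
      have "\<beta> * (1 + d y / L) \<le> (1 + \<epsilon> / (2 * L)) * (1 + d y / L)"
        using True pos \<open>0 < L\<close> by (intro mult_right_mono) (auto simp: \<beta>_def)
      also have "\<dots> = 1 + d y / L + \<epsilon> / (2 * L) * (1 + d y / L)"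
        by (simp add: algebra_simps)
      also have "\<epsilon> / (2 * L) * (1 + d y / L) \<le> \<epsilon> / (2 * L) * 2"
        using pos \<open>0 < L\<close> dL[of y] by (intro mult_left_mono) (auto simp: field_simps)
      also have "1 + d y / L + \<epsilon> / (2 * L) * 2 = 1 + (d y + \<epsilon>) / L"
        using \<open>0 < L\<close> by (simp add: field_simps)
      also have "\<dots> \<le> 1 + d (y' / lam) / L"
        using d \<open>0 < L\<close> by (simp add: divide_right_mono)
      finally show ?thesis using True d by (simp add: h_def)
    qed (use h0 in \<open>simp add: h_def\<close>)
  qed
  have "expansion_weight lam \<beta> \<epsilon> \<delta> h"
  proof (unfold_locales, fold L_def)
    show "h y \<le> 1" for y using h_le[of y] by simp
    show "0 < h y \<Longrightarrow> 0 \<le> y \<and> y \<le> L" for y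
      using pos by (auto simp: h_def d_def split: if_splits)
    show "1 / 2 \<le> h y" if "\<delta> \<le> y" "y \<le> L - \<delta>" for y
    proof -
      have "\<delta> \<le> d y" using that by (auto simp: d_def)
      thus ?thesis using pos \<open>0 < L\<close> by (simp add: h_def)
    qed
    show "\<beta> * h y \<le> h (y' / lam) + h (y' / lam - 1)" if yy: "\<bar>y - y'\<bar> \<le> \<epsilon>" for y y'
    proof -
      \<comment> \<open>Outside the cut-off \<open>h y = 0\<close>; near either end one digit gives
        the gain; in the middle both digits lead to residuals at least \<open>\<delta>\<close>
        inside \<open>[0, L]\<close>.\<close>
      consider "d y < \<delta>" | "\<delta> \<le> d y" "y \<le> lam + \<eta>" | "\<delta> \<le> d y" "L - y \<le> lam + \<eta>"
        | "lam + \<eta> < y" "lam + \<eta> < L - y" by linarith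
      thus ?thesis
      proof cases
        case 1
        thus ?thesis using h0 by (simp add: h_def)
      next
        case 2
        hence "\<beta> * h y \<le> h (y' / lam)" using yy by (intro left) (auto simp: d_def)
        thus ?thesis using h0[of "y' / lam - 1"] by simp
      next
        case 3
        hence "\<beta> * h (L - y) \<le> h ((L - y') / lam)" using yy by (intro left) (auto simp: d_def)
        thus ?thesis using h0[of "y' / lam"] by (simp add: h_sym Ll)
      next
        case 4
        have *: "1 + \<delta> \<le> z / lam" if "lam + \<delta> \<le> z" for z
        proof -
          have "(1 + \<delta>) * lam \<le> lam + \<delta>" using pos lam by (simp add: distrib_right)
          thus ?thesis using that lam by (simp add: field_simps)
        qed
        have "1 + \<delta> \<le> y' / lam" "1 + \<delta> \<le> L - (y' / lam - 1)"
          using *[of y'] *[of "L - y'"] 4 yy pos by (auto simp: Ll)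
        hence "\<delta> \<le> d (y' / lam)" "\<delta> \<le> d (y' / lam - 1)"
          by (auto simp: d_def)
        hence "1 / 2 \<le> h (y' / lam)" "1 / 2 \<le> h (y' / lam - 1)"
          using pos \<open>0 < L\<close> by (simp_all add: h_def)
        moreover have "\<beta> * h y \<le> (4 / 3) * ((1 + 1 / 2) / 2)"
          unfolding \<beta>_def by (intro mult_mono h_le h0 min.cobounded1) simp
        ultimately show ?thesis by simp
      qed
    qed
  qed (use pos h0 lam in auto)
  thus thesis by (rule that)
qed

section \<open>Independent coins\<close>

lemma space_coin_space [simp]: "space coin_space = UNIV"
  by (simp add: coin_space_def space_PiM PiE_def extensional_def)

lemma prob_space_coin_space: "prob_space coin_space"
  unfolding coin_space_def by (intro prob_space_PiM measure_pmf.prob_space_axioms)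

interpretation coin: prob_space coin_space
  by (rule prob_space_coin_space)

lemma sets_coin_space: "sets coin_space = sets (\<Pi>\<^sub>M v\<in>UNIV. count_space UNIV)"
  unfolding coin_space_def by (intro sets_PiM_cong) auto

lemma measurable_coin [measurable]: "(\<lambda>a. a v) \<in> measurable coin_space (count_space UNIV)"
proof -
  have "(\<lambda>a. a v) \<in> measurable coin_space (measure_pmf (bernoulli_pmf (1/2)))"
    unfolding coin_space_def by (rule measurable_component_singleton) simp
  thus ?thesis by simp
qed

lemma distr_coin:
  "distr coin_space (measure_pmf (bernoulli_pmf (1/2))) (\<lambda>a. a v) = measure_pmf (bernoulli_pmf (1/2))"
  unfolding coin_space_def
  by (rule distr_PiM_component) (auto intro: measure_pmf.prob_space_axioms)

lemma indep_coins: "coin.indep_vars (\<lambda>_. measure_pmf (bernoulli_pmf (1/2))) (\<lambda>v a. a v) UNIV"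
proof (subst coin.indep_vars_iff_distr_eq_PiM)
  show "distr coin_space (\<Pi>\<^sub>M i\<in>UNIV. measure_pmf (bernoulli_pmf (1/2))) (\<lambda>x. \<lambda>i\<in>UNIV. x i) =
    (\<Pi>\<^sub>M i\<in>UNIV. distr coin_space (measure_pmf (bernoulli_pmf (1/2))) (\<lambda>a. a i))"
    unfolding distr_coin coin_space_def[symmetric] by (simp add: restrict_UNIV distr_id2)
qed auto

lemma coin_integral:
  fixes g :: "bool \<Rightarrow> real"
  shows "(\<integral>a. g (a v) \<partial>coin_space) = (g True + g False) / 2"
proof -
  have "(\<integral>a. g (a v) \<partial>coin_space) = (\<integral>b. g b \<partial>measure_pmf (bernoulli_pmf (1/2)))"
    using integral_distr[of "\<lambda>a. a v" coin_space "measure_pmf (bernoulli_pmf (1/2))" g]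
    by (simp add: distr_coin)
  thus ?thesis by (simp add: field_simps)
qed

lemma
  fixes g :: "bool list \<Rightarrow> bool \<Rightarrow> real"
  assumes "finite D"
  shows coin_integral_prod: "(\<integral>a. (\<Prod>w\<in>D. g w (a w)) \<partial>coin_space) = (\<Prod>w\<in>D. (g w True + g w False) / 2)"
    and integrable_coin_prod: "integrable coin_space (\<lambda>a. \<Prod>w\<in>D. g w (a w))"
proof -
  have ind: "coin.indep_vars (\<lambda>_. borel) (\<lambda>w a. g w (a w)) D"
    by (rule coin.indep_vars_compose2[OF coin.indep_vars_subset[OF indep_coins]]) auto
  have int: "integrable coin_space (\<lambda>a. g w (a w))" for w
  proof (rule coin.integrable_const_bound)
    show "AE a in coin_space. norm (g w (a w)) \<le> max \<bar>g w True\<bar> \<bar>g w False\<bar>"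
    proof (rule AE_I2)
      show "norm (g w (a w)) \<le> max \<bar>g w True\<bar> \<bar>g w False\<bar>" for a
        by (cases "a w") auto
    qed
  qed measurable
  show "integrable coin_space (\<lambda>a. \<Prod>w\<in>D. g w (a w))"
    by (rule coin.indep_vars_integrable[OF assms ind int])
  show "(\<integral>a. (\<Prod>w\<in>D. g w (a w)) \<partial>coin_space) = (\<Prod>w\<in>D. (g w True + g w False) / 2)"
    by (subst coin.indep_vars_lebesgue_integral[OF assms ind int]) (simp add: coin_integral)
qed

section \<open>Subtrees as independent copies of the tree\<close>

lemma measurable_subtree [measurable]: "subtree v \<in> measurable coin_space coin_space"
proof -
  have "(\<lambda>a w. a (v @ w)) \<in> measurable coin_space (\<Pi>\<^sub>M v\<in>UNIV. count_space UNIV)"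
    using measurable_restrict[of UNIV "\<lambda>w a. a (v @ w)" coin_space "\<lambda>_. count_space UNIV"]
    by (simp add: restrict_UNIV)
  moreover have "measurable coin_space coin_space = measurable coin_space (\<Pi>\<^sub>M v\<in>UNIV. count_space UNIV)"
    by (rule measurable_cong_sets[OF refl sets_coin_space])
  ultimately show ?thesis
    by (simp add: subtree_def[abs_def])
qed

lemma distr_subtree: "distr coin_space coin_space (subtree v) = coin_space"
proof -
  have "inj ((@) v)" by (simp add: inj_def)
  hence "distr coin_space coin_space (\<lambda>a. \<lambda>w\<in>UNIV. a (v @ w)) = coin_space"
    unfolding coin_space_def
    by (intro distr_PiM_reindex[where f = "(@) v" and I = UNIV]) (auto intro: measure_pmf.prob_space_axioms)
  thus ?thesis by (simp add: subtree_def[abs_def] restrict_UNIV)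
qed

lemma prob_subtree:
  assumes "X \<in> sets coin_space"
  shows "coin.prob (subtree v -` X) = coin.prob X"
  using measure_distr[OF measurable_subtree assms, of v] by (simp add: distr_subtree)

text \<open>The two subtrees read the disjoint label sets of words beginning with
  \<open>True\<close> and with \<open>False\<close>, hence are independent, and each has the law of
  the whole tree.\<close>

lemma prob_subtree_inter:
  assumes X: "X \<in> sets coin_space"
  shows "coin.prob (subtree [True] -` X \<inter> subtree [False] -` X) = (coin.prob X)\<^sup>2"
proof -
  let ?M = "\<lambda>_::bool list. measure_pmf (bernoulli_pmf (1/2))"
  let ?K = "\<lambda>b. range ((#) b) :: bool list set"
  have "coin.indep_vars (\<lambda>b. PiM (?K b) ?M) (\<lambda>b a. restrict (\<lambda>v. a v) (?K b)) UNIV"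
    by (rule coin.indep_vars_restrict[OF indep_coins]) (auto simp: disjoint_family_on_def)
  moreover have "(\<lambda>c w. c (b # w)) \<in> measurable (PiM (?K b) ?M) coin_space" for b
  proof -
    have "(\<lambda>c. \<lambda>w\<in>UNIV. c (b # w)) \<in> measurable (PiM (?K b) ?M) (PiM UNIV ?M)"
      by (intro measurable_restrict measurable_component_singleton) auto
    thus ?thesis by (simp add: coin_space_def restrict_UNIV)
  qed
  ultimately have "coin.indep_vars (\<lambda>_. coin_space)
      (\<lambda>b a. (\<lambda>c w. c (b # w)) (restrict (\<lambda>v. a v) (?K b))) UNIV"
    by (rule coin.indep_vars_compose2)
  also have "(\<lambda>b a. (\<lambda>c w. c (b # w)) (restrict (\<lambda>v. a v) (?K b))) = (\<lambda>b. subtree [b])"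
    by (simp add: subtree_def fun_eq_iff)
  finally have ind: "coin.indep_vars (\<lambda>_. coin_space) (\<lambda>b. subtree [b]) UNIV" .
  have "coin.prob (\<Inter>b. subtree [b] -` X) = (\<Prod>b\<in>UNIV. coin.prob (subtree [b] -` X))"
    using coin.indep_varsD_finite[OF ind, of "\<lambda>_. X"] X by simp
  moreover have "(\<Inter>b. subtree [b] -` X) = subtree [True] -` X \<inter> subtree [False] -` X"
    by (auto simp: UNIV_bool)
  ultimately show ?thesis
    by (simp add: prob_subtree[OF X] power2_eq_square UNIV_bool)
qed

text \<open>A zero-one law. The event \<open>Z\<close> that no subtree lies in \<open>X\<close> is
  inherited by both subtrees of the root, so its probability is at most its own square, and it is
  below 1 because \<open>Z\<close> misses \<open>X\<close>. Countability of the words gives all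
  \<open>v\<close> at once.\<close>

lemma AE_some_subtree:
  assumes X: "X \<in> sets coin_space" and pos: "coin.prob X > 0"
  shows "AE a in coin_space. \<forall>v. \<exists>w. subtree (v @ w) a \<in> X"
proof -
  define Z where "Z = {a. \<forall>w. subtree w a \<notin> X}"
  have "Z = space coin_space - (\<Union>w. subtree w -` X \<inter> space coin_space)"
    by (auto simp: Z_def)
  also have "\<dots> \<in> sets coin_space"
    using measurable_sets[OF measurable_subtree X] by (intro sets.Diff sets.top sets.countable_UN) auto
  finally have Z: "Z \<in> sets coin_space" .
  have "Z \<subseteq> subtree [True] -` Z \<inter> subtree [False] -` Z"
    by (auto simp: Z_def subtree_append)
  hence "coin.prob Z \<le> (coin.prob Z)\<^sup>2"
    using measurable_sets[OF measurable_subtree Z] prob_subtree_inter[OF Z]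
    by (metis coin.finite_measure_mono sets.Int space_coin_space Int_UNIV_right)
  moreover have "coin.prob Z < 1"
  proof -
    have "Z \<subseteq> space coin_space - X"
      by (auto simp: Z_def subtree_def dest: spec[of _ "[]"])
    hence "coin.prob Z \<le> 1 - coin.prob X"
      using X by (metis coin.finite_measure_mono coin.prob_compl sets.compl_sets)
    with pos show ?thesis by simp
  qed
  ultimately have "coin.prob Z = 0"
    using mult_left_less_imp_less[of "coin.prob Z" 1 "coin.prob Z"] measure_nonneg[of coin_space Z]
    by (metis power2_eq_square mult.right_neutral mult_less_cancel_left_pos not_le order_le_less)
  hence "AE a in coin_space. a \<notin> Z"
    using Z by (simp add: AE_iff_measurable[OF Z] coin.emeasure_eq_measure)
  hence "AE a in coin_space. subtree v a \<notin> Z" for v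
    using AE_distrD[OF measurable_subtree[of v], of "\<lambda>a. a \<notin> Z"] unfolding distr_subtree by blast
  hence "AE a in coin_space. \<forall>v. subtree v a \<notin> Z"
    by (simp add: AE_all_countable)
  thus ?thesis
    by eventually_elim (simp add: Z_def subtree_append)
qed

section \<open>Levels of the tree and finitely many labels\<close>

definition words :: "nat \<Rightarrow> bool list set" where
  "words n = {v. length v = n}"

definition words_upto :: "nat \<Rightarrow> bool list set" where
  "words_upto n = {v. length v \<le> n}"

lemma words_mem_upto: "v \<in> words m \<Longrightarrow> m \<le> n \<Longrightarrow> v \<in> words_upto n"
  by (simp add: words_def words_upto_def)

lemma finite_words [simp]: "finite (words n)"
  using finite_lists_length_eq[of "UNIV :: bool set" n] by (simp add: words_def)

lemma finite_words_upto [simp]: "finite (words_upto n)"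
  using finite_lists_length_le[of "UNIV :: bool set" n] by (simp add: words_upto_def)

lemma card_words: "card (words n) = 2 ^ n"
  using card_lists_length_eq[of "UNIV :: bool set" n] by (simp add: words_def)

lemma bij_betw_words_Suc: "bij_betw (\<lambda>(v, b). v @ [b]) (words n \<times> UNIV) (words (Suc n))"
proof (rule bij_betw_imageI)
  show "(\<lambda>(v, b). v @ [b]) ` (words n \<times> UNIV) = words (Suc n)"
  proof (intro equalityI subsetI)
    fix w assume "w \<in> words (Suc n)"
    then obtain v b where "w = v @ [b]" "v \<in> words n"
      by (cases w rule: rev_cases) (auto simp: words_def)
    thus "w \<in> (\<lambda>(v, b). v @ [b]) ` (words n \<times> UNIV)" by force
  qed (auto simp: words_def)
qed (auto simp: inj_on_def)

lemma sum_words_Suc: "(\<Sum>w\<in>words (Suc n). f w) = (\<Sum>v\<in>words n. \<Sum>b\<in>UNIV. f (v @ [b]))"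
  using sum.reindex_bij_betw[OF bij_betw_words_Suc[of n], of f]
  by (simp add: sum.cartesian_product case_prod_unfold)

lemma prod_words_Suc: "(\<Prod>w\<in>words (Suc n). f w) = (\<Prod>v\<in>words n. \<Prod>b\<in>UNIV. f (v @ [b]))"
  using prod.reindex_bij_betw[OF bij_betw_words_Suc[of n], of f]
  by (simp add: prod.cartesian_product case_prod_unfold)

text \<open>Such an event is a finite union of cylinders. This makes events about the weights
  measurable for an arbitrary function \<open>h\<close>.\<close>

lemma sets_coin_finite_dependence:
  assumes "finite D" and dep: "\<And>a. P (restrict a D) \<longleftrightarrow> P a"
  shows "{a. P a} \<in> sets coin_space"
proof -
  define C where "C = {c \<in> D \<rightarrow>\<^sub>E UNIV. P c}"
  have "finite C"
    unfolding C_def using finite_PiE[OF \<open>finite D\<close>, of "\<lambda>_. UNIV :: bool set"] by simp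
  have "{a. P a} = (\<Union>c\<in>C. {a \<in> space coin_space. \<forall>w\<in>D. a w = c w})"
  proof (intro equalityI subsetI)
    fix a assume "a \<in> {a. P a}"
    hence "restrict a D \<in> C" using dep by (simp add: C_def)
    thus "a \<in> (\<Union>c\<in>C. {a \<in> space coin_space. \<forall>w\<in>D. a w = c w})"
      by (rule UN_I) simp
  next
    fix a assume "a \<in> (\<Union>c\<in>C. {a \<in> space coin_space. \<forall>w\<in>D. a w = c w})"
    then obtain c where c: "c \<in> C" "\<forall>w\<in>D. a w = c w" by auto
    hence "restrict a D = c"
      by (intro PiE_ext[of _ D "\<lambda>_. UNIV"]) (auto simp: C_def)
    thus "a \<in> {a. P a}" using c dep[of a] by (simp add: C_def)
  qed
  also have "\<dots> \<in> sets coin_space"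
    using \<open>finite C\<close> \<open>finite D\<close> by (intro sets.finite_UN) measurable
  finally show ?thesis .
qed

lemma
  fixes F :: "(bool list \<Rightarrow> bool) \<Rightarrow> real" and G :: "(bool list \<Rightarrow> bool) \<Rightarrow> bool list \<Rightarrow> bool \<Rightarrow> real"
  assumes fin: "finite D" "finite E" and disj: "D \<inter> E = {}"
    and F: "\<And>a. F (restrict a D) = F a" and G: "\<And>a. G (restrict a D) = G a"
  shows coin_integral_condition_sum:
      "(\<integral>a. F a * (\<Prod>w\<in>E. G a w (a w)) \<partial>coin_space) =
       (\<Sum>c\<in>D \<rightarrow>\<^sub>E UNIV. F c * ((1 / 2) ^ card D * (\<Prod>w\<in>E. (G c w True + G c w False) / 2)))"
    and integrable_coin_condition: "integrable coin_space (\<lambda>a. F a * (\<Prod>w\<in>E. G a w (a w)))"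
proof -
  \<comment> \<open>For a fixed configuration \<open>c\<close> on \<open>D\<close>, the factors on
    \<open>D\<close> test agreement with \<open>c\<close> and those on \<open>E\<close> use
    \<open>G c\<close>. Each summand is thus a product of functions of single coins, and the sum
    over \<open>c\<close> recovers the integrand.\<close>
  define g :: "(bool list \<Rightarrow> bool) \<Rightarrow> bool list \<Rightarrow> bool \<Rightarrow> real"
    where "g c w b = (if w \<in> D then of_bool (b = c w) else G c w b)" for c w b
  have split: "(\<Prod>w\<in>D \<union> E. g c w (a w)) = (\<Prod>w\<in>D. of_bool (a w = c w)) * (\<Prod>w\<in>E. G c w (a w))" for c a
  proof -
    have "(\<Prod>w\<in>E. g c w (a w)) = (\<Prod>w\<in>E. G c w (a w))"
      using disj by (intro prod.cong) (auto simp: g_def)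
    thus ?thesis
      using fin disj by (simp add: prod.union_disjoint g_def)
  qed
  have avg: "(\<Prod>w\<in>D \<union> E. (g c w True + g c w False) / 2) =
      (1 / 2) ^ card D * (\<Prod>w\<in>E. (G c w True + G c w False) / 2)" for c
  proof -
    have "(\<Prod>w\<in>E. (g c w True + g c w False) / 2) = (\<Prod>w\<in>E. (G c w True + G c w False) / 2)"
      using disj by (intro prod.cong) (auto simp: g_def)
    moreover have "(\<Prod>w\<in>D. (g c w True + g c w False) / 2) = (\<Prod>w\<in>D. 1 / 2)"
      by (intro prod.cong) (auto simp: g_def)
    ultimately show ?thesis
      using fin disj by (simp add: prod.union_disjoint)
  qed
  have expand: "F a * (\<Prod>w\<in>E. G a w (a w)) = (\<Sum>c\<in>D \<rightarrow>\<^sub>E UNIV. F c * (\<Prod>w\<in>D \<union> E. g c w (a w)))" for a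
  proof -
    have "F c * (\<Prod>w\<in>D \<union> E. g c w (a w)) = (if c = restrict a D then F a * (\<Prod>w\<in>E. G a w (a w)) else 0)"
      if c: "c \<in> D \<rightarrow>\<^sub>E UNIV" for c
    proof (cases "c = restrict a D")
      case True
      thus ?thesis by (simp add: split F G)
    next
      case False
      then obtain w where "w \<in> D" "a w \<noteq> c w"
        using PiE_ext[OF c, of "restrict a D"] by auto
      hence "(\<Prod>w\<in>D. of_bool (a w = c w)) = (0::real)"
        using fin by (intro prod_zero) auto
      with False show ?thesis by (simp add: split)
    qed
    thus ?thesis
      using fin by (simp add: finite_PiE sum.delta)
  qed
  show "integrable coin_space (\<lambda>a. F a * (\<Prod>w\<in>E. G a w (a w)))"
    unfolding expand using fin by (intro Bochner_Integration.integrable_sum integrable_mult_right integrable_coin_prod) auto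
  show "(\<integral>a. F a * (\<Prod>w\<in>E. G a w (a w)) \<partial>coin_space) =
       (\<Sum>c\<in>D \<rightarrow>\<^sub>E UNIV. F c * ((1 / 2) ^ card D * (\<Prod>w\<in>E. (G c w True + G c w False) / 2)))"
    unfolding expand using fin
    by (subst Bochner_Integration.integral_sum)
      (auto intro!: integrable_mult_right integrable_coin_prod simp: coin_integral_prod avg)
qed

text \<open>Conditioning on the coins in \<open>D\<close>, the coins in \<open>E\<close> are averaged out.\<close>

lemma coin_integral_condition:
  fixes F :: "(bool list \<Rightarrow> bool) \<Rightarrow> real" and G :: "(bool list \<Rightarrow> bool) \<Rightarrow> bool list \<Rightarrow> bool \<Rightarrow> real"
  assumes "finite D" "finite E" "D \<inter> E = {}"
    and "\<And>a. F (restrict a D) = F a" and "\<And>a. G (restrict a D) = G a"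
  shows "(\<integral>a. F a * (\<Prod>w\<in>E. G a w (a w)) \<partial>coin_space) =
         (\<integral>a. F a * (\<Prod>w\<in>E. (G a w True + G a w False) / 2) \<partial>coin_space)"
  \<comment> \<open>Both integrals equal the same finite sum over configurations on
    \<open>D\<close>: the second instance moves the average into \<open>F\<close> and takes
    \<open>E\<close> empty.\<close>
  using coin_integral_condition_sum[of D E F G]
    coin_integral_condition_sum[of D "{}" "\<lambda>a. F a * (\<Prod>w\<in>E. (G a w True + G a w False) / 2)" "\<lambda>_ _ _. 0"]
    assms by (simp add: mult_ac)

lemma integrable_coin_finite_dependence:
  fixes F :: "(bool list \<Rightarrow> bool) \<Rightarrow> real"
  assumes "finite D" "\<And>a. F (restrict a D) = F a"
  shows "integrable coin_space F"
  using integrable_coin_condition[of D "{}" F "\<lambda>_ _ _. 0"] assms by simp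

text \<open>The starting event: all \<open>2 ^ m\<close> vertices at level \<open>m\<close> leave
  the same residual, so the weight there can be of order \<open>2 ^ m\<close>.\<close>

definition root_zero :: "nat \<Rightarrow> (bool list \<Rightarrow> bool) set" where
  "root_zero m = {a. \<forall>w\<in>words_upto m. \<not> a w}"

lemma root_zero_restrict: "m \<le> n \<Longrightarrow> restrict a (words_upto n) \<in> root_zero m \<longleftrightarrow> a \<in> root_zero m"
  by (auto simp: root_zero_def words_upto_def)

lemma sets_root_zero [measurable]: "root_zero m \<in> sets coin_space"
  unfolding root_zero_def by (rule sets_coin_finite_dependence[of "words_upto m"]) auto

lemma prob_root_zero_pos: "0 < coin.prob (root_zero m)"
proof -
  have eq: "indicator (root_zero m) a = (\<Prod>w\<in>words_upto m. of_bool (\<not> a w) :: real)" for a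
    by (auto simp: indicator_def root_zero_def intro!: prod_zero)
  have "coin.prob (root_zero m) = (\<integral>a. indicator (root_zero m) a \<partial>coin_space)"
    by simp
  also have "\<dots> = (\<integral>a. (\<Prod>w\<in>words_upto m. of_bool (\<not> a w)) \<partial>coin_space)"
    by (simp only: eq)
  also have "\<dots> = (1 / 2) ^ card (words_upto m)"
    by (subst coin_integral_prod[of "words_upto m" "\<lambda>_ b. of_bool (\<not> b)"]) auto
  finally show ?thesis by simp
qed

section \<open>Nets and the rate of decay for the union bound\<close>

lemma finite_net:
  fixes A B r :: real
  assumes "A \<le> B" "0 < r"
  obtains G where "finite G" "G \<subseteq> {A..B}" "real (card G) \<le> (B - A) / r + 1"
    "\<And>x. x \<in> {A..B} \<Longrightarrow> \<exists>g\<in>G. \<bar>g - x\<bar> \<le> r"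
proof
  define k where "k = nat \<lfloor>(B - A) / r\<rfloor>"
  have k: "real k \<le> (B - A) / r"
    using assms by (simp add: k_def)
  let ?G = "(\<lambda>i. A + r * real i) ` {..k}"
  show "finite ?G" by simp
  show "?G \<subseteq> {A..B}"
  proof clarsimp
    fix i assume "i \<le> k"
    hence "real i \<le> (B - A) / r" using k by linarith
    thus "0 \<le> r * real i \<and> A + r * real i \<le> B" using assms by (simp add: field_simps)
  qed
  have "card ?G \<le> k + 1" using card_image_le[of "{..k}" "\<lambda>i. A + r * real i"] by simp
  thus "real (card ?G) \<le> (B - A) / r + 1" using k by linarith
  fix x assume x: "x \<in> {A..B}"
  define i where "i = nat \<lfloor>(x - A) / r\<rfloor>"
  have i: "real i \<le> (x - A) / r" "(x - A) / r < real i + 1"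
    using x assms by (simp_all add: i_def)
  have "(x - A) / r \<le> (B - A) / r" using x assms by (simp add: divide_right_mono)
  hence "i \<le> k" by (simp add: i_def k_def nat_mono floor_mono)
  moreover have "\<bar>(A + r * real i) - x\<bar> \<le> r" using i assms by (simp add: field_simps abs_le_iff)
  ultimately show "\<exists>g\<in>?G. \<bar>g - x\<bar> \<le> r" by blast
qed

text \<open>Bernoulli's inequality \<open>\<rho> ^ k \<ge> 1 + k * (\<rho> - 1)\<close> turns the
  left side into a geometric sequence whose first term and ratio both tend to 0 as \<open>M\<close>
  grows. The bounds on the right sum to \<open>1 / 2\<close>.\<close>

lemma double_exponential_decay:
  fixes C lam \<rho> :: real
  assumes "0 < lam" "1 < \<rho>"
  shows "\<forall>\<^sub>F M in at_top. \<forall>k. C / lam ^ Suc k * exp (- (M * \<rho> ^ k)) \<le> (1 / 4) * (1 / 2) ^ k"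
proof -
  have lim: "((\<lambda>M. K * exp (- (M * c))) \<longlongrightarrow> 0) at_top" if "c > 0" for c K :: real
    using that by real_asymp
  have "\<forall>\<^sub>F M in at_top. \<bar>C\<bar> / lam * exp (- (M * 1)) < 1 / 4"
    by (rule order_tendstoD(2)[OF lim]) auto
  moreover have "\<forall>\<^sub>F M in at_top. 1 / lam * exp (- (M * (\<rho> - 1))) < 1 / 2"
    using assms by (intro order_tendstoD(2)[OF lim]) auto
  moreover have "\<forall>\<^sub>F M in at_top. (0::real) \<le> M" by (rule eventually_ge_at_top)
  ultimately show ?thesis
  proof eventually_elim
    case (elim M)
    show ?case
    proof
      fix k
      have "1 + real k * (\<rho> - 1) \<le> (1 + (\<rho> - 1)) ^ k"
        using assms by (intro Bernoulli_inequality) auto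
      hence "M * (1 + real k * (\<rho> - 1)) \<le> M * \<rho> ^ k"
        using elim(3) by (intro mult_left_mono) auto
      hence "exp (- (M * \<rho> ^ k)) \<le> exp (- (M * 1) + real k * (- (M * (\<rho> - 1))))"
        by (simp add: algebra_simps)
      also have "\<dots> = exp (- (M * 1)) * exp (- (M * (\<rho> - 1))) ^ k"
        by (simp only: exp_add exp_of_nat_mult)
      finally have "C / lam ^ Suc k * exp (- (M * \<rho> ^ k)) \<le>
          \<bar>C\<bar> / lam ^ Suc k * (exp (- (M * 1)) * exp (- (M * (\<rho> - 1))) ^ k)"
        using assms by (intro mult_mono divide_right_mono) auto
      also have "\<dots> = (\<bar>C\<bar> / lam * exp (- (M * 1))) * (1 / lam * exp (- (M * (\<rho> - 1)))) ^ k"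
        by (simp add: power_mult_distrib power_divide mult_ac)
      also have "\<dots> \<le> (1 / 4) * (1 / 2) ^ k"
        using elim(1,2) assms by (intro mult_mono power_mono) auto
      finally show "C / lam ^ Suc k * exp (- (M * \<rho> ^ k)) \<le> (1 / 4) * (1 / 2) ^ k" .
    qed
  qed
qed

section \<open>Growth of the weights\<close>

context expansion_weight
begin

abbreviation L :: real where "L \<equiv> lam / (1 - lam)"

text \<open>A smoothed count of the words of length \<open>n\<close> whose residual is still in
  \<open>[0, L]\<close>; by \<open>h_le_1\<close> and \<open>h_pos\<close> it is at most that
  number.\<close>

definition weight :: "(bool list \<Rightarrow> bool) \<Rightarrow> nat \<Rightarrow> real \<Rightarrow> real" where
  "weight a n x = (\<Sum>v\<in>words n. h ((x - partial_sum lam a v) / lam ^ n))"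

lemma partial_sum_restrict:
  "v \<in> words_upto n \<Longrightarrow> partial_sum lam (restrict a (words_upto n)) v = partial_sum lam a v"
  by (intro partial_sum_cong) (auto simp: words_upto_def)

lemma weight_restrict: "m \<le> n \<Longrightarrow> weight (restrict a (words_upto n)) m x = weight a m x"
  unfolding weight_def by (intro sum.cong refl) (simp add: partial_sum_restrict words_mem_upto)

text \<open>Separates the fresh label \<open>a w\<close> from \<open>butlast w\<close>, whose
  partial sum is determined by the first \<open>n\<close> levels, as conditioning requires.\<close>

lemma weight_Suc:
  "weight a (Suc n) x =
     (\<Sum>w\<in>words (Suc n). h ((x - partial_sum lam a (butlast w)) / lam ^ n / lam - of_bool (a w)))"
  unfolding weight_def sum_words_Suc
proof (intro sum.cong refl)
  fix v b assume "v \<in> words n"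
  thus "h ((x - partial_sum lam a (v @ [b])) / lam ^ Suc n) =
      h ((x - partial_sum lam a (butlast (v @ [b]))) / lam ^ n / lam - of_bool (a (v @ [b])))"
    using lam by (simp add: partial_sum_snoc words_def field_simps)
qed

section \<open>Exponential moments of the weight\<close>

lemma exp_le_chord:
  fixes t u :: real
  assumes "0 \<le> u" "u \<le> 1"
  shows "exp (- (t * u)) \<le> 1 - (1 - exp (- t)) * u"
proof -
  have "exp ((1 - u) *\<^sub>R 0 + u *\<^sub>R (- t)) \<le> (1 - u) * exp 0 + u * exp (- t)"
    by (rule convex_onD[OF exp_convex assms]) auto
  thus ?thesis by (simp add: algebra_simps)
qed

text \<open>The chord bound makes the average linear in \<open>h\<close>, so that
  \<open>h_expand\<close> applies. The remaining factor \<open>1 / 2\<close> in the exponent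
  disappears later, since each vertex has two children.\<close>

lemma average_exp_le:
  assumes "\<bar>y - y'\<bar> \<le> \<epsilon>" "0 \<le> t"
  shows "(exp (- (t * h (y' / lam - 1))) + exp (- (t * h (y' / lam)))) / 2 \<le> exp (- ((1 - exp (- t)) * \<beta> * h y) / 2)"
proof -
  define s where "s = 1 - exp (- t)"
  have "s \<ge> 0" using assms by (simp add: s_def)
  have "(exp (- (t * h (y' / lam - 1))) + exp (- (t * h (y' / lam)))) / 2
      \<le> ((1 - s * h (y' / lam - 1)) + (1 - s * h (y' / lam))) / 2"
    unfolding s_def by (intro divide_right_mono add_mono exp_le_chord h_nonneg h_le_1) auto
  also have "\<dots> = 1 - s * (h (y' / lam) + h (y' / lam - 1)) / 2"
    by (simp add: field_simps)
  also have "\<dots> \<le> 1 + - (s * (\<beta> * h y)) / 2"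
    using mult_left_mono[OF h_expand[OF assms(1)] \<open>s \<ge> 0\<close>] by simp
  also have "\<dots> \<le> exp (- (s * (\<beta> * h y)) / 2)"
    by (rule exp_ge_add_one_self)
  finally show ?thesis by (simp add: s_def mult.assoc)
qed

lemma exp_weight_moment:
  assumes A: "\<And>a. restrict a (words_upto n) \<in> A \<longleftrightarrow> a \<in> A"
    and x: "\<bar>x - x'\<bar> \<le> \<epsilon> * lam ^ n" and t: "0 \<le> t"
  shows "(\<integral>a. indicator A a * exp (- (t * weight a (Suc n) x')) \<partial>coin_space)
    \<le> (\<integral>a. indicator A a * exp (- ((1 - exp (- t)) * \<beta> * weight a n x)) \<partial>coin_space)"
proof -
  define Y where "Y a w = (x' - partial_sum lam a (butlast w)) / lam ^ n" for a w
  \<comment> \<open>The value 1 off level \<open>Suc n\<close> makes \<open>G\<close> as a whole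
    depend only on the first \<open>n\<close> levels, for longer words too.\<close>
  define G where "G a w b = (if w \<in> words (Suc n) then exp (- (t * h (Y a w / lam - of_bool b))) else 1)" for a w b
  have G_restrict: "G (restrict a (words_upto n)) = G a" for a
  proof -
    have "butlast w \<in> words_upto n" if "w \<in> words (Suc n)" for w
      using that by (simp add: words_def words_upto_def)
    thus ?thesis by (simp add: G_def Y_def fun_eq_iff partial_sum_restrict)
  qed
  have disj: "words_upto n \<inter> words (Suc n) = {}"
    by (auto simp: words_def words_upto_def)
  have A': "indicator A (restrict a (words_upto n)) = (indicator A a :: real)" for a
    using A by (simp add: indicator_def)
  have "exp (- (t * weight a (Suc n) x')) = (\<Prod>w\<in>words (Suc n). G a w (a w))" for a
    unfolding weight_Suc G_def Y_def by (simp add: exp_sum sum_distrib_left flip: sum_negf)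
  hence "(\<integral>a. indicator A a * exp (- (t * weight a (Suc n) x')) \<partial>coin_space) =
      (\<integral>a. indicator A a * (\<Prod>w\<in>words (Suc n). (G a w True + G a w False) / 2) \<partial>coin_space)"
    using coin_integral_condition[of "words_upto n" "words (Suc n)" "indicator A" G] disj A' G_restrict by simp
  also have "\<dots> \<le> (\<integral>a. indicator A a * exp (- ((1 - exp (- t)) * \<beta> * weight a n x)) \<partial>coin_space)"
  proof (rule integral_mono)
    fix a
    \<comment> \<open>Siblings share their \<open>butlast\<close>, hence their averaged factor,
      which gives the square.\<close>
    have "(\<Prod>w\<in>words (Suc n). (G a w True + G a w False) / 2) =
        (\<Prod>v\<in>words n. ((G a (v @ [True]) True + G a (v @ [True]) False) / 2)\<^sup>2)"
      unfolding prod_words_Suc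
      by (auto intro!: prod.cong simp: UNIV_bool G_def Y_def power2_eq_square words_def)
    also have "\<dots> \<le> (\<Prod>v\<in>words n. exp (- ((1 - exp (- t)) * \<beta> * h ((x - partial_sum lam a v) / lam ^ n)) / 2) ^ 2)"
    proof (intro prod_mono conjI power_mono zero_le_power2)
      fix v assume v: "v \<in> words n"
      have "\<bar>(x - partial_sum lam a v) / lam ^ n - (x' - partial_sum lam a v) / lam ^ n\<bar> = \<bar>x - x'\<bar> / lam ^ n"
        using lam by (simp flip: diff_divide_distrib)
      also have "\<dots> \<le> \<epsilon>" using x lam by (simp add: field_simps)
      finally have "(exp (- (t * h ((x' - partial_sum lam a v) / lam ^ n / lam - 1))) +
          exp (- (t * h ((x' - partial_sum lam a v) / lam ^ n / lam)))) / 2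
          \<le> exp (- ((1 - exp (- t)) * \<beta> * h ((x - partial_sum lam a v) / lam ^ n)) / 2)"
        by (rule average_exp_le[OF _ t])
      thus "(G a (v @ [True]) True + G a (v @ [True]) False) / 2
          \<le> exp (- ((1 - exp (- t)) * \<beta> * h ((x - partial_sum lam a v) / lam ^ n)) / 2)"
        using v by (simp add: G_def Y_def words_def)
    qed (simp add: G_def)
    also have "\<dots> = (\<Prod>v\<in>words n. exp (- ((1 - exp (- t)) * \<beta> * h ((x - partial_sum lam a v) / lam ^ n))))"
      by (intro prod.cong refl) (simp flip: exp_double)
    also have "\<dots> = exp (- ((1 - exp (- t)) * \<beta> * weight a n x))"
      unfolding weight_def by (simp add: exp_sum sum_distrib_left flip: sum_negf)
    finally show "indicator A a * (\<Prod>w\<in>words (Suc n). (G a w True + G a w False) / 2)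
        \<le> indicator A a * exp (- ((1 - exp (- t)) * \<beta> * weight a n x))"
      by (simp add: indicator_def)
  qed (rule integrable_coin_finite_dependence[of "words_upto n"];
       simp add: A' G_restrict weight_restrict)+
  finally show ?thesis .
qed

lemma sets_weight [measurable]:
  "{a. Q (weight a n x)} \<in> sets coin_space"
  by (rule sets_coin_finite_dependence[of "words_upto n"]) (simp_all add: weight_restrict)

text \<open>A Chernoff bound: Markov's inequality for the exponential of the new weight, then
  \<open>exp_weight_moment\<close>, then the lower bound \<open>N\<close> on the old weight. The
  factor \<open>coin.prob (root_zero m)\<close> is kept so that the failures can be compared with
  \<open>root_zero m\<close>, however rare it is.\<close>

lemma prob_weight_drop:
  assumes mn: "m \<le> n" and x: "\<bar>x - x'\<bar> \<le> \<epsilon> * lam ^ n" and t: "0 \<le> t" and N: "0 \<le> N"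
  shows "coin.prob (root_zero m \<inter> {a. N \<le> weight a n x} \<inter> {a. weight a (Suc n) x' < \<rho> * N})
    \<le> coin.prob (root_zero m) * exp (- (((1 - exp (- t)) * \<beta> - t * \<rho>) * N))"
proof -
  define A where "A = root_zero m \<inter> {a. N \<le> weight a n x}"
  define B where "B = A \<inter> {a. weight a (Suc n) x' < \<rho> * N}"
  define s where "s = (1 - exp (- t)) * \<beta>"
  have "s \<ge> 0" using t \<beta> by (simp add: s_def)
  have A: "restrict a (words_upto n) \<in> A \<longleftrightarrow> a \<in> A" for a
    using mn by (simp add: A_def root_zero_restrict weight_restrict)
  have [measurable]: "A \<in> sets coin_space" "B \<in> sets coin_space"
    by (simp_all add: A_def B_def sets_weight sets_root_zero sets.Int)
  have int: "integrable coin_space (\<lambda>a. indicator A a * exp (- (c * weight a k y)))" if "k \<le> Suc n" for c k y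
  proof (rule integrable_coin_finite_dependence[of "words_upto (Suc n)"])
    fix a
    have "restrict a (words_upto (Suc n)) \<in> A \<longleftrightarrow> a \<in> A"
      using mn by (simp add: A_def root_zero_restrict weight_restrict)
    thus "indicator A (restrict a (words_upto (Suc n))) * exp (- (c * weight (restrict a (words_upto (Suc n))) k y)) =
        indicator A a * exp (- (c * weight a k y))"
      using that by (simp add: weight_restrict indicator_def)
  qed simp
  have "coin.prob B = (\<integral>a. indicator B a \<partial>coin_space)"
    by simp
  also have "\<dots> \<le> (\<integral>a. exp (t * \<rho> * N) * (indicator A a * exp (- (t * weight a (Suc n) x'))) \<partial>coin_space)"
  proof (rule integral_mono)
    fix a
    show "indicator B a \<le> exp (t * \<rho> * N) * (indicator A a * exp (- (t * weight a (Suc n) x')))"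
    proof (cases "a \<in> B")
      case True
      hence "t * weight a (Suc n) x' \<le> t * (\<rho> * N)"
        using t by (intro mult_left_mono) (auto simp: B_def)
      hence "1 \<le> exp (t * \<rho> * N + - (t * weight a (Suc n) x'))"
        by (simp add: mult.assoc)
      also have "\<dots> = exp (t * \<rho> * N) * (indicator A a * exp (- (t * weight a (Suc n) x')))"
        using True by (simp add: B_def flip: exp_add)
      finally show ?thesis using True by simp
    qed simp
  qed (use int[of "Suc n"] in \<open>auto intro: integrable_real_indicator simp: coin.emeasure_eq_measure\<close>)
  also have "\<dots> = exp (t * \<rho> * N) * (\<integral>a. indicator A a * exp (- (t * weight a (Suc n) x')) \<partial>coin_space)"
    by simp
  also have "\<dots> \<le> exp (t * \<rho> * N) * (\<integral>a. indicator A a * exp (- (s * weight a n x)) \<partial>coin_space)"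
    unfolding s_def by (intro mult_left_mono exp_weight_moment[OF A x t]) auto
  also have "(\<integral>a. indicator A a * exp (- (s * weight a n x)) \<partial>coin_space)
      \<le> (\<integral>a. indicator (root_zero m) a * exp (- (s * N)) \<partial>coin_space)"
  proof (rule integral_mono)
    fix a
    show "indicator A a * exp (- (s * weight a n x)) \<le> indicator (root_zero m) a * exp (- (s * N))"
      using mult_left_mono[of N "weight a n x" s] \<open>s \<ge> 0\<close> by (auto simp: A_def indicator_def)
  qed (use int[of n] in \<open>auto intro!: integrable_mult_left integrable_real_indicator simp: coin.emeasure_eq_measure\<close>)
  also have "\<dots> = coin.prob (root_zero m) * exp (- (s * N))"
    by simp
  also have "exp (t * \<rho> * N) * (coin.prob (root_zero m) * exp (- (s * N)))
      = coin.prob (root_zero m) * exp (- ((s - t * \<rho>) * N))"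
    by (simp add: algebra_simps flip: exp_add)
  finally show ?thesis
    by (simp add: A_def B_def s_def)
qed

lemma weight_root_zero:
  assumes "a \<in> root_zero m" "x \<in> {lam ^ m * \<delta>..lam ^ m * (L - \<delta>)}"
  shows "2 ^ m / 2 \<le> weight a m x"
proof -
  have "partial_sum lam a v = 0" if "v \<in> words m" for v
    unfolding partial_sum_def using that assms(1)
    by (intro sum.neutral) (auto simp: words_def root_zero_def words_upto_def)
  hence "weight a m x = 2 ^ m * h (x / lam ^ m)"
    by (simp add: weight_def card_words)
  moreover have "1 / 2 \<le> h (x / lam ^ m)"
    using assms(2) lam by (intro h_ge) (simp_all add: pos_le_divide_eq pos_divide_le_eq mult.commute)
  ultimately show ?thesis
    using mult_left_mono[of "1 / 2" "h (x / lam ^ m)" "2 ^ m"] by simp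
qed

lemma approx_if_weight_pos:
  assumes "0 < weight a n x"
  shows "\<exists>v. length v = n \<and> \<bar>x - partial_sum lam a v\<bar> \<le> L * lam ^ n"
proof -
  obtain v where v: "v \<in> words n" "0 < h ((x - partial_sum lam a v) / lam ^ n)"
    using assms h_nonneg unfolding weight_def by (meson not_le sum_nonpos)
  define q where "q = (x - partial_sum lam a v) / lam ^ n"
  have "0 \<le> q" "q \<le> L"
    using h_pos[OF v(2)] by (simp_all add: q_def)
  moreover have "x - partial_sum lam a v = q * lam ^ n"
    using lam by (simp add: q_def)
  ultimately have "\<bar>x - partial_sum lam a v\<bar> \<le> L * lam ^ n"
    using lam by (simp add: abs_mult mult_right_mono del: times_divide_eq_left)
  thus ?thesis using v(1) by (auto simp: words_def)
qed

section \<open>An interval in the support with positive probability\<close>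

lemma growth_rate:
  obtains t \<rho> where "0 \<le> t" "1 < \<rho>" "0 < (1 - exp (- t)) * \<beta> - t * \<rho>"
proof
  \<comment> \<open>With \<open>\<rho> = (1 + \<beta>) / 2\<close> this \<open>t\<close> gives
    \<open>(1 + t) * \<rho> = (1 + 3 * \<beta>) / 4 < \<beta>\<close>, which suffices because
    \<open>1 - exp (- t) \<ge> t / (1 + t)\<close>.\<close>
  define t where "t = (\<beta> - 1) / (2 * (1 + \<beta>))"
  have t: "0 < t" using \<beta> by (simp add: t_def)
  show "0 \<le> t" "1 < (1 + \<beta>) / 2" using t \<beta> by auto
  have "exp (- t) \<le> 1 / (1 + t)"
    using exp_ge_add_one_self[of t] t by (simp add: exp_minus field_simps)
  hence "t / (1 + t) \<le> 1 - exp (- t)" using t by (simp add: field_simps)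
  hence "t / (1 + t) * \<beta> \<le> (1 - exp (- t)) * \<beta>" using \<beta> by (intro mult_right_mono) auto
  moreover have "(1 + t) * ((1 + \<beta>) / 2) < \<beta>"
    using \<beta> less_1_mult[OF \<beta> \<beta>] by (simp add: t_def field_simps)
  hence "(1 + \<beta>) / 2 < \<beta> / (1 + t)"
    using t by (simp add: pos_less_divide_eq mult.commute)
  hence "t * ((1 + \<beta>) / 2) < t / (1 + t) * \<beta>"
    using mult_strict_left_mono[OF _ t, of "(1 + \<beta>) / 2" "\<beta> / (1 + t)"] by simp
  ultimately show "0 < (1 - exp (- t)) * \<beta> - t * ((1 + \<beta>) / 2)"
    unfolding diff_gt_0_iff_gt by (rule order_less_le_trans[rotated])
qed

lemma positive_prob_interior:
  obtains X where "X \<in> sets coin_space" "0 < coin.prob X"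
    "\<And>a. a \<in> X \<Longrightarrow> interior (rand_support lam a) \<noteq> {}"
proof -
  obtain t \<rho> where t: "0 \<le> t" "1 < \<rho>" "0 < (1 - exp (- t)) * \<beta> - t * \<rho>"
    by (rule growth_rate)
  define \<kappa> where "\<kappa> = (1 - exp (- t)) * \<beta> - t * \<rho>"
  define C where "C = L / \<epsilon> + 1"
  have "0 < \<kappa>" using t by (simp add: \<kappa>_def)
  hence "filterlim (\<lambda>m. \<kappa> / 2 * 2 ^ m) at_top sequentially"
    by real_asymp
  hence "\<forall>\<^sub>F m in sequentially. \<forall>k. C / lam ^ Suc k * exp (- (\<kappa> / 2 * 2 ^ m * \<rho> ^ k)) \<le> (1 / 4) * (1 / 2) ^ k"
    using double_exponential_decay[OF lam(1) t(2), of C] by (auto simp: filterlim_iff)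
  then obtain m where m: "\<And>k. C / lam ^ Suc k * exp (- (\<kappa> / 2 * 2 ^ m * \<rho> ^ k)) \<le> (1 / 4) * (1 / 2) ^ k"
    by (auto simp: eventually_sequentially)
  define J where "J = {lam ^ m * \<delta>..lam ^ m * (L - \<delta>)}"
  define N where "N k = 2 ^ m / 2 * \<rho> ^ k" for k
  have N_pos: "0 < N k" for k using t by (simp add: N_def)
  have J: "lam ^ m * \<delta> < lam ^ m * (L - \<delta>)"
    using lam \<delta> by simp
  \<comment> \<open>The length of \<open>J\<close> is below \<open>L * lam ^ m\<close>, so
    \<open>lam ^ m\<close> cancels against the mesh and \<open>C\<close> is independent of
    \<open>m\<close>; hence \<open>m\<close> could be chosen after \<open>C\<close>.\<close>
  have "\<exists>G. finite G \<and> G \<subseteq> J \<and> real (card G) \<le> C / lam ^ k \<and> (\<forall>x\<in>J. \<exists>g\<in>G. \<bar>g - x\<bar> \<le> \<epsilon> * lam ^ (m + k))" for k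
  proof -
    have "0 < \<epsilon> * lam ^ (m + k)" using lam \<epsilon> by simp
    from finite_net[OF less_imp_le[OF J] this] obtain G where G: "finite G" "G \<subseteq> J"
      "real (card G) \<le> (lam ^ m * (L - \<delta>) - lam ^ m * \<delta>) / (\<epsilon> * lam ^ (m + k)) + 1"
      "\<And>x. x \<in> J \<Longrightarrow> \<exists>g\<in>G. \<bar>g - x\<bar> \<le> \<epsilon> * lam ^ (m + k)"
      unfolding J_def by metis
    have "lam ^ m * (L - \<delta>) - lam ^ m * \<delta> = lam ^ m * (L - 2 * \<delta>)"
      by (simp only: right_diff_distrib)
    hence "(lam ^ m * (L - \<delta>) - lam ^ m * \<delta>) / (\<epsilon> * lam ^ (m + k)) = (L - 2 * \<delta>) / \<epsilon> / lam ^ k"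
      using lam by (simp add: power_add mult.left_commute[of \<epsilon>])
    also have "\<dots> \<le> L / \<epsilon> / lam ^ k"
      using lam \<delta> \<epsilon> by (intro divide_right_mono) auto
    finally have "real (card G) \<le> L / \<epsilon> / lam ^ k + 1"
      using G(3) by (rule order_trans[OF _ add_right_mono, rotated])
    also have "\<dots> \<le> L / \<epsilon> / lam ^ k + 1 / lam ^ k"
      using lam power_le_one[of lam k] by (intro add_left_mono) simp
    also have "\<dots> = C / lam ^ k"
      by (simp add: C_def add_divide_distrib)
    finally show ?thesis
      using G(1,2,4) by (intro exI[of _ G] conjI ballI)
  qed
  then obtain G where "\<forall>k. finite (G k) \<and> G k \<subseteq> J \<and> real (card (G k)) \<le> C / lam ^ k \<and>
      (\<forall>x\<in>J. \<exists>g\<in>G k. \<bar>g - x\<bar> \<le> \<epsilon> * lam ^ (m + k))"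
    using choice[of "\<lambda>k G. finite G \<and> G \<subseteq> J \<and> real (card G) \<le> C / lam ^ k \<and>
      (\<forall>x\<in>J. \<exists>g\<in>G. \<bar>g - x\<bar> \<le> \<epsilon> * lam ^ (m + k))"] by auto
  hence G: "\<And>k. finite (G k)" "\<And>k. G k \<subseteq> J" "\<And>k. real (card (G k)) \<le> C / lam ^ k"
    "\<And>k x. x \<in> J \<Longrightarrow> \<exists>g\<in>G k. \<bar>g - x\<bar> \<le> \<epsilon> * lam ^ (m + k)"
    by auto
  define p where "p k x = (SOME g. g \<in> G k \<and> \<bar>g - x\<bar> \<le> \<epsilon> * lam ^ (m + k))" for k x
  have p: "p k x \<in> G k" "\<bar>p k x - x\<bar> \<le> \<epsilon> * lam ^ (m + k)" if "x \<in> J" for k x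
    using someI_ex[OF G(4)[OF that, of k, unfolded Bex_def]] by (auto simp: p_def)
  \<comment> \<open>Failure in passing from level \<open>m + k\<close> to the next: some point of
    the finer net falls below its threshold although its neighbour \<open>p k x\<close> in the
    coarser net reached it.\<close>
  define F where "F k = (\<Union>x\<in>G (Suc k). root_zero m \<inter> {a. N k \<le> weight a (m + k) (p k x)}
      \<inter> {a. weight a (Suc (m + k)) x < \<rho> * N k})" for k
  have F_sets: "F k \<in> sets coin_space" for k
    unfolding F_def using G(1) by (intro sets.finite_UN sets.Int sets_weight sets_root_zero)
  have F_prob: "coin.prob (F k) \<le> coin.prob (root_zero m) * (1 / 4) * (1 / 2) ^ k" for k
  proof -
    have "coin.prob (F k) \<le> (\<Sum>x\<in>G (Suc k). coin.prob (root_zero m \<inter> {a. N k \<le> weight a (m + k) (p k x)}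
      \<inter> {a. weight a (Suc (m + k)) x < \<rho> * N k}))"
      unfolding F_def using G(1) by (intro coin.finite_measure_subadditive_finite)
        (auto intro!: sets.Int sets_weight sets_root_zero)
    also have "\<dots> \<le> (\<Sum>x\<in>G (Suc k). coin.prob (root_zero m) * exp (- (\<kappa> * N k)))"
      unfolding \<kappa>_def using G(2) p(2) t(1) N_pos[of k]
      by (intro sum_mono prob_weight_drop) (auto simp: less_imp_le)
    also have "\<dots> = coin.prob (root_zero m) * (real (card (G (Suc k))) * exp (- (\<kappa> * N k)))"
      by simp
    also have "\<dots> \<le> coin.prob (root_zero m) * (C / lam ^ Suc k * exp (- (\<kappa> / 2 * 2 ^ m * \<rho> ^ k)))"
      using G(3)[of "Suc k"] by (intro mult_left_mono mult_mono) (auto simp: N_def)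
    also have "\<dots> \<le> coin.prob (root_zero m) * ((1 / 4) * (1 / 2) ^ k)"
      by (intro mult_left_mono m) simp
    finally show ?thesis by simp
  qed
  define X where "X = root_zero m - (\<Union>k. F k)"
  have X_sets: "X \<in> sets coin_space"
    unfolding X_def using F_sets by (intro sets.Diff sets_root_zero sets.countable_UN) auto
  \<comment> \<open>The failures together take at most half of the probability of
    \<open>root_zero m\<close>, so \<open>X\<close> keeps positive probability.\<close>
  have geo: "(\<lambda>k. coin.prob (root_zero m) * (1 / 4) * (1 / 2) ^ k) sums (coin.prob (root_zero m) * (1 / 4) * 2)"
    using sums_mult[OF geometric_sums[of "1 / 2 :: real"], of "coin.prob (root_zero m) * (1 / 4)"] by simp
  have "summable (\<lambda>k. coin.prob (F k))"
    using F_prob by (intro summable_comparison_test'[OF sums_summable[OF geo], of 0]) simp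
  hence "coin.prob (\<Union>k. F k) \<le> (\<Sum>k. coin.prob (F k))"
    using F_sets by (intro coin.finite_measure_subadditive_countably) auto
  also have "\<dots> \<le> coin.prob (root_zero m) * (1 / 4) * 2"
    using suminf_le[OF F_prob \<open>summable (\<lambda>k. coin.prob (F k))\<close> sums_summable[OF geo]] sums_unique[OF geo] by simp
  finally have "coin.prob (\<Union>k. F k) < coin.prob (root_zero m)"
    using prob_root_zero_pos[of m] by simp
  moreover have "coin.prob (root_zero m) \<le> coin.prob X + coin.prob (\<Union>k. F k)"
    using F_sets X_sets
    by (intro order_trans[OF coin.finite_measure_mono measure_Un_le]) (auto simp: X_def)
  ultimately have X_prob: "0 < coin.prob X" by simp
  have "interior (rand_support lam a) \<noteq> {}" if a: "a \<in> X" for a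
  proof -
    have grow: "\<forall>x\<in>G k. N k \<le> weight a (m + k) x" for k
    proof (induction k)
      case 0
      show ?case
        using weight_root_zero[of a m] a G(2)[of 0] by (auto simp: X_def N_def J_def)
    next
      case (Suc k)
      show ?case
      proof
        fix x assume x: "x \<in> G (Suc k)"
        hence "N k \<le> weight a (m + k) (p k x)"
          using Suc p(1) G(2) by blast
        moreover have "a \<notin> F k" "a \<in> root_zero m" using a by (auto simp: X_def)
        ultimately have "\<rho> * N k \<le> weight a (Suc (m + k)) x"
          using x by (auto simp: F_def not_less)
        thus "N (Suc k) \<le> weight a (m + Suc k) x" by (simp add: N_def mult_ac)
      qed
    qed
    have "J \<subseteq> rand_support lam a"
    proof
      fix x assume x: "x \<in> J"
      show "x \<in> rand_support lam a"
      \<comment> \<open>In the constant, \<open>L\<close> bounds the residual of the net point and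
        \<open>\<epsilon>\<close> the distance from \<open>x\<close> to it.\<close>
      proof (rule mem_rand_support_if_approx[OF lam, of m _ _ "L + \<epsilon>"])
        fix n assume "m \<le> n"
        define k where "k = n - m"
        have n: "n = m + k" using \<open>m \<le> n\<close> by (simp add: k_def)
        have "0 < weight a n (p k x)"
          using grow[of k] p(1)[OF x, of k] N_pos[of k] unfolding n by force
        from approx_if_weight_pos[OF this] obtain v where
          v: "length v = n" "\<bar>p k x - partial_sum lam a v\<bar> \<le> L * lam ^ n" by blast
        have "\<bar>x - partial_sum lam a v\<bar> \<le> (L + \<epsilon>) * lam ^ n"
          using v(2) p(2)[OF x, of k] unfolding n[symmetric] distrib_right by linarith
        thus "\<exists>v. length v = n \<and> \<bar>x - partial_sum lam a v\<bar> \<le> (L + \<epsilon>) * lam ^ n"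
          using v(1) by blast
      qed
    qed
    hence "interior J \<subseteq> interior (rand_support lam a)" by (rule interior_mono)
    moreover have "interior J \<noteq> {}" using J by (simp add: J_def interior_atLeastAtMost_real)
    ultimately show ?thesis by blast
  qed
  with X_sets X_prob show thesis by (rule that)
qed

end

theorem theorem1p7:
  fixes lam :: real
  assumes "(sqrt 5 - 1) / 2 < lam" and "lam < 1"
  shows "AE a in coin_space.
           interior (rand_support lam a) \<noteq> {} \<and>
           closure (interior (rand_support lam a)) = rand_support lam a"
proof -
  obtain h \<beta> \<epsilon> \<delta> where "expansion_weight lam \<beta> \<epsilon> \<delta> h"
    by (rule expansion_weight_exists[OF assms])
  then interpret expansion_weight lam \<beta> \<epsilon> \<delta> h .
  obtain X where X: "X \<in> sets coin_space" "0 < coin.prob X"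
    "\<And>a. a \<in> X \<Longrightarrow> interior (rand_support lam a) \<noteq> {}"
    by (rule positive_prob_interior) blast
  from AE_some_subtree[OF X(1,2)] show ?thesis
  proof eventually_elim
    case (elim a)
    have "\<exists>w. interior (rand_support lam (subtree (v @ w) a)) \<noteq> {}" for v
      using elim X(3) by blast
    hence cl: "closure (interior (rand_support lam a)) = rand_support lam a"
      by (rule closure_interior_rand_support[OF lam])
    \<comment> \<open>An empty interior would have empty closure, so the closure identity also
      yields a nonempty interior.\<close>
    moreover have "rand_support lam a \<noteq> {}" by (simp add: rand_support_def)
    ultimately show ?case by auto
  qed
qed

end
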